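(* Let $\mathbf{s}_1,\dots,\mathbf{s}_N$ and $\mathbf{c}_1,\dots,\mathbf{c}_M$ be unit vectors in $\mathbb{R}^3$, let $\alpha_\epsilon \ge 0$, and let $K$ be an integer with $0 \le K \le \min(N-1, M-1)$. Let $Q_{\mathrm{ROSIA}}$ and $\overline{Q}_{\mathrm{ROSIA}}$ be the objective function and bounding function associated with these data, as defined in the context. Then for any cube $\mathbb{B} = \{\mathbf{u}, \alpha_{\mathbb{B}}\}$ in the axis-angle parameter space $\mathbb{R}^3$, $$\overline{Q}_{\mathrm{ROSIA}}(\mathbb{B}) \;\ge\; \max_{\mathbf{r}\in\mathbb{B}} Q_{\mathrm{ROSIA}}(\mathbf{R}_{\mathbf{r}}).$$ Moreover, when $\mathbb{B}$ collapses to a single point $\mathbf{r}$ (that is, $\mathbf{u} = \mathbf{r}$ and $\alpha_{\mathbb{B}} = 0$), $$\overline{Q}_{\mathrm{ROSIA}}(\mathbb{B}) = Q_{\mathrm{ROSIA}}(\mathbf{R}_{\mathbf{r}}).$$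
   Context: Angles: for unit vectors $\mathbf{x},\mathbf{y}\in\mathbb{R}^3$, $\angle(\mathbf{x},\mathbf{y})\in[0,\pi]$ denotes the angle between them. Indicator: $\lfloor P \rfloor$ equals $1$ if the relation $P$ is true and $0$ otherwise (it is not the floor function). Axis-angle parameterization: for $\mathbf{r}\in\mathbb{R}^3$, $\mathbf{R}_{\mathbf{r}}\in SO(3)$ is the rotation about the axis $\mathbf{r}/\|\mathbf{r}\|$ by the angle $\|\mathbf{r}\|$ (with $\mathbf{R}_{\mathbf{0}}$ the identity), i.e. $\mathbf{R}_{\mathbf{r}}=\exp([\mathbf{r}]_\times)$, where $[\mathbf{r}]_\times$ is the skew-symmetric matrix with $[\mathbf{r}]_\times \mathbf{x}=\mathbf{r}\times\mathbf{x}$. Cubes: a cube $\mathbb{B}=\{\mathbf{u},\alpha_{\mathbb{B}}\}$ is a closed axis-aligned cube in $\mathbb{R}^3$ with center $\mathbf{u}$, where $\alpha_{\mathbb{B}}$ is the Euclidean distance from $\mathbf{u}$ to a vertex of the cube, equivalently $\alpha_{\mathbb{B}}=\max_{\mathbf{r}\in\mathbb{B}}\|\mathbf{u}-\mathbf{r}\|$. (The cubes of interest are the cube $[-\pi,\pi]^3$ enclosing the ball of radius $\pi$ and the sub-cubes obtained from it by repeatedly splitting a cube evenly into eight.) The degenerate case of a single point has $\alpha_{\mathbb{B}}=0$. Sorted angular distances: for each $i\in\{1,\dots,N\}$, $\theta^{(i)}_1\le\theta^{(i)}_2\le\dots\le\theta^{(i)}_{N-1}$ are the angular distances $\angle(\mathbf{s}_i,\mathbf{s}_{l})$,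 $l\ne i$, sorted in non-decreasing order. For each $j\in\{1,\dots,M\}$, $\phi^{(j)}_1\le\dots\le\phi^{(j)}_{M-1}$ are the angular distances $\angle(\mathbf{c}_j,\mathbf{c}_{l})$, $l\neq j$, sorted in non-decreasing order. Objective function: for $\mathbf{R}\in SO(3)$, $$Q_{\mathrm{ROSIA}}(\mathbf{R}) := \sum_{i=1}^{N}\max_{1\le j\le M}\Big(\lfloor \angle(\mathbf{R}\mathbf{s}_i,\mathbf{c}_j)\le\alpha_\epsilon\rfloor\prod_{k=1}^{K}\lfloor |\theta^{(i)}_k-\phi^{(j)}_k|\le 2\alpha_\epsilon\rfloor\Big).$$ Bounding function: for a cube $\mathbb{B}=\{\mathbf{u},\alpha_{\mathbb{B}}\}$, $$\overline{Q}_{\mathrm{ROSIA}}(\mathbb{B}) := \sum_{i=1}^{N}\max_{1\le j\le M}\Big(\lfloor \angle(\mathbf{R}_{\mathbf{u}}\mathbf{s}_i,\mathbf{c}_j)\le\alpha_\epsilon+\alpha_{\mathbb{B}}\rfloor\prod_{k=1}^{K}\lfloor |\theta^{(i)}_k-\phi^{(j)}_k|\le 2\alpha_\epsilon\rfloor\Big).$$ *)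

theory Defs
  imports "HOL-Analysis.Analysis"
begin

definition angle :: "real^3 \<Rightarrow> real^3 \<Rightarrow> real" where
  "angle x y = arccos ((x \<bullet> y) / (norm x * norm y))"

definition hat :: "real^3 \<Rightarrow> real^3^3" where
  "hat r = matrix (\<lambda>x. cross3 r x)"

text \<open>
  The operations \<open>*\<close> and \<open>^\<close> on vectors and matrices are componentwise, so powers with
  respect to the matrix product \<open>**\<close> are written as iterates here.
\<close>

definition matrix_exp :: "real^'n^'n \<Rightarrow> real^'n^'n" where
  "matrix_exp A = (\<Sum>n. (1 / fact n) *\<^sub>R (((\<lambda>X. A ** X) ^^ n) (mat 1)))"

definition axis_angle_rot :: "real^3 \<Rightarrow> real^3^3" where
  "axis_angle_rot r = matrix_exp (hat r)"

text \<open>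
  \<open>B\<close> is the closed axis-aligned cube with centre \<open>u\<close> and half side length \<open>h\<close>, and \<open>\<alpha>\<close> is the
  distance from \<open>u\<close> to the vertex \<open>u + vec h\<close>. The case \<open>h = 0\<close> is a single point.
\<close>

definition is_cube :: "(real^3) set \<Rightarrow> real^3 \<Rightarrow> real \<Rightarrow> bool" where
  "is_cube B u \<alpha> \<longleftrightarrow>
     (\<exists>h\<ge>0. B = cbox (u - vec h) (u + vec h) \<and> \<alpha> = dist u (u + vec h))"

text \<open>
  \<open>sorted_dist n v i k\<close> is the \<open>k\<close>-th smallest (counting from 1, with multiplicity) of the
  angular distances from \<open>v i\<close> to the other vectors among \<open>v 1, \<dots>, v n\<close>; it is meaningful for
  \<open>1 \<le> k \<le> n - 1\<close>.
\<close>

definition sorted_dist :: "nat \<Rightarrow> (nat \<Rightarrow> real^3) \<Rightarrow> nat \<Rightarrow> nat \<Rightarrow> real" where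
  "sorted_dist n v i k =
     sort (map (\<lambda>l. angle (v i) (v l)) (filter (\<lambda>l. l \<noteq> i) [1..<n+1])) ! (k - 1)"

definition Q_ROSIA ::
  "nat \<Rightarrow> nat \<Rightarrow> nat \<Rightarrow> real \<Rightarrow> (nat \<Rightarrow> real^3) \<Rightarrow> (nat \<Rightarrow> real^3) \<Rightarrow> real^3^3 \<Rightarrow> nat" where
  "Q_ROSIA N M K \<epsilon> s c R =
     (\<Sum>i=1..N. MAX j\<in>{1..M}.
        of_bool (angle (R *v s i) (c j) \<le> \<epsilon>) *
        (\<Prod>k=1..K. of_bool (\<bar>sorted_dist N s i k - sorted_dist M c j k\<bar> \<le> 2 * \<epsilon>)))"

definition Qbar_ROSIA ::
  "nat \<Rightarrow> nat \<Rightarrow> nat \<Rightarrow> real \<Rightarrow> (nat \<Rightarrow> real^3) \<Rightarrow> (nat \<Rightarrow> real^3) \<Rightarrow> real^3 \<Rightarrow> real \<Rightarrow> nat" where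
  "Qbar_ROSIA N M K \<epsilon> s c u \<alpha> =
     (\<Sum>i=1..N. MAX j\<in>{1..M}.
        of_bool (angle (axis_angle_rot u *v s i) (c j) \<le> \<epsilon> + \<alpha>) *
        (\<Prod>k=1..K. of_bool (\<bar>sorted_dist N s i k - sorted_dist M c j k\<bar> \<le> 2 * \<epsilon>)))"

text \<open>
  For \<open>M \<ge> 1\<close> the objective only takes values in \<open>{0..N}\<close>, so its set of values over a
  cube is finite and nonempty, and \<open>Max\<close> of that set is its true maximum.
\<close>

end

theory Submission
  imports Defs
begin

text \<open>
  The rotations by \<open>u\<close> and \<open>r\<close> move any unit vector to points at angle at most \<open>dist u r\<close>. For
  \<open>r\<close> in the cube this is at most \<open>\<alpha>\<close>, so the spherical triangle inequality shows that every
  indicator that is 1 in the objective at \<open>r\<close> is also 1 in the bounding function.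
\<close>

unbundle cross3_syntax

subsection \<open>Angles between unit vectors\<close>

lemma angle_unit: "norm p = 1 \<Longrightarrow> norm q = 1 \<Longrightarrow> angle p q = arccos (p \<bullet> q)"
  by (simp add: angle_def)

lemma inner_unit_bounds:
  fixes p q :: "'a::real_inner"
  assumes "norm p = 1" "norm q = 1"
  shows "-1 \<le> p \<bullet> q" "p \<bullet> q \<le> 1"
  using Cauchy_Schwarz_ineq2[of p q] assms by auto

text \<open>Removing from \<open>p\<close> and \<open>r\<close> their components along
  \<open>q\<close> leaves vectors whose norms are the sines of the two angles. Cauchy-Schwarz for
  these vectors bounds the cosine of the angle sum by \<open>p \<bullet> r\<close>, and
  \<open>arccos\<close> is antitone. A sum above \<open>pi\<close> needs only that
  \<open>arccos\<close> never exceeds \<open>pi\<close>.\<close>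

lemma angle_triangle:
  assumes p: "norm p = 1" and q: "norm q = 1" and r: "norm r = 1"
  shows "angle p r \<le> angle p q + angle q r"
proof (cases "angle p q + angle q r \<le> pi")
  case False
  then show ?thesis
    using arccos_ubound[of "p \<bullet> r"] inner_unit_bounds[OF p r] by (simp add: angle_unit p r)
next
  case True
  define a b where "a = p \<bullet> q" and "b = q \<bullet> r"
  have ab: "-1 \<le> a" "a \<le> 1" "-1 \<le> b" "b \<le> 1"
    using inner_unit_bounds[OF p q] inner_unit_bounds[OF q r] by (auto simp: a_def b_def)
  have sq: "p \<bullet> p = 1" "q \<bullet> q = 1" "r \<bullet> r = 1"
    using p q r by (simp_all add: norm_eq_1)
  have 1: "norm (p - a *\<^sub>R q) = sqrt (1 - a\<^sup>2)"
    by (simp add: norm_eq_sqrt_inner inner_diff inner_commute[of q p] sq a_def power2_eq_square algebra_simps)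
  have 2: "norm (r - b *\<^sub>R q) = sqrt (1 - b\<^sup>2)"
    by (simp add: norm_eq_sqrt_inner inner_diff inner_commute[of r q] sq b_def power2_eq_square algebra_simps)
  have 3: "(p - a *\<^sub>R q) \<bullet> (r - b *\<^sub>R q) = p \<bullet> r - a * b"
    by (simp add: inner_diff sq a_def b_def algebra_simps)
  have "cos (arccos a + arccos b) \<le> p \<bullet> r"
    using Cauchy_Schwarz_ineq2[of "p - a *\<^sub>R q" "r - b *\<^sub>R q"] ab
    unfolding 1 2 3 cos_add by (simp add: sin_arccos_abs sin_arccos cos_arccos)
  then have "arccos (p \<bullet> r) \<le> arccos (cos (arccos a + arccos b))"
    using inner_unit_bounds[OF p r] by (intro arccos_le_arccos) auto
  also have "\<dots> = arccos a + arccos b"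
    using True ab by (intro arccos_cos) (auto simp: angle_unit p q r a_def b_def arccos_lbound)
  finally show ?thesis
    by (simp add: angle_unit p q r a_def b_def)
qed

lemma abs_sin_minus_le: "\<bar>sin t - t\<bar> \<le> t\<^sup>2 / 2" for t :: real
  using Maclaurin_sin_bound[of t 2] by (simp add: sin_coeff_def numeral_2_eq_2 field_simps)

lemma one_minus_cos_le: "1 - cos t \<le> t\<^sup>2 / 2" for t :: real
proof -
  have "(sin (t/2))\<^sup>2 \<le> (t/2)\<^sup>2"
    unfolding abs_le_square_iff[symmetric] by (rule abs_sin_x_le_abs_x)
  then show ?thesis
    using cos_double_sin[of "t/2"] by (simp add: power_divide)
qed

text \<open>The chord has coefficient exactly 1 and the correction is quadratic, so the correction
  vanishes in the limit when many small angles are summed.\<close>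

lemma angle_le_chord:
  assumes p: "norm p = 1" and q: "norm q = 1"
  shows "angle p q \<le> norm (p - q) + (norm (p - q) / (1 - pi / 4))\<^sup>2 / 4"
proof -
  define x d where "x = angle p q" and "d = norm (p - q)"
  have x: "0 \<le> x" "x \<le> pi"
    using inner_unit_bounds[OF p q] by (auto simp: x_def angle_unit p q arccos_lbound arccos_ubound)
  have pi: "pi / 4 < 1"
    using pi_less_4 by simp
  have "d\<^sup>2 = 2 - 2 * cos x"
    using inner_unit_bounds[OF p q] p q
    by (simp add: d_def x_def angle_unit power2_norm_eq_inner norm_eq_1 inner_diff inner_commute)
  also have "\<dots> = (2 * sin (x / 2))\<^sup>2"
    using cos_double_sin[of "x/2"] by (simp add: power_mult_distrib)
  finally have "d = 2 * sin (x / 2)"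
    using x by (subst (asm) power2_eq_iff_nonneg) (auto simp: d_def sin_ge_zero)
  then have le: "x - x\<^sup>2 / 4 \<le> d"
    using abs_sin_minus_le[of "x/2"] unfolding power_divide abs_le_iff by simp
  \<comment> \<open>A crude linear bound on \<open>x\<close> comes first, using
    \<open>pi < 4\<close>; it then replaces the \<open>x\<close> in the quadratic term of
    \<open>le\<close>.\<close>
  have "x * x \<le> x * pi"
    using x by (intro mult_left_mono) auto
  then have "(1 - pi / 4) * x \<le> d"
    using le by (simp add: power2_eq_square algebra_simps)
  then have "x \<le> d / (1 - pi / 4)"
    using pi by (simp add: field_simps)
  then have "x\<^sup>2 \<le> (d / (1 - pi / 4))\<^sup>2"
    using x by (intro power_mono) auto
  then show ?thesis
    using le unfolding x_def[symmetric] d_def[symmetric] by simp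
qed

subsection \<open>Rodrigues' formula\<close>

text \<open>For a unit axis \<open>k\<close> this is the rotation by the angle \<open>t\<close>.
  Written with iterated cross products only, it can be read as a polynomial in the skew matrix
  \<open>hat k\<close>.\<close>

definition rodrigues :: "real^3 \<Rightarrow> real \<Rightarrow> real^3 \<Rightarrow> real^3" where
  "rodrigues k t x = x + sin t *\<^sub>R (k \<times> x) + (1 - cos t) *\<^sub>R (k \<times> (k \<times> x))"

lemma cross_diff_left: "(x - y) \<times> z = x \<times> z - y \<times> z"
  by (simp add: cross3_simps)

lemma cross_diff_right: "x \<times> (y - z) = x \<times> y - x \<times> z"
  by (simp add: cross3_simps)

lemma cross3_cross3_cross3_unit: "norm k = 1 \<Longrightarrow> k \<times> (k \<times> (k \<times> x)) = - (k \<times> x)"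
  by (simp add: Lagrange[of k k x] norm_eq_1 cross_mult_right cross_diff_right)

lemma rodrigues_add:
  assumes "norm k = 1"
  shows "rodrigues k a (rodrigues k b x) = rodrigues k (a + b) x"
  by (simp add: rodrigues_def cross_add_right cross_diff_right cross_mult_right
      cross3_cross3_cross3_unit assms
      sin_add cos_add algebra_simps)

lemma rodrigues_0 [simp]: "rodrigues k 0 = id"
  by (simp add: rodrigues_def fun_eq_iff)

lemma rodrigues_funpow:
  assumes "norm k = 1"
  shows "(rodrigues k t ^^ n) = rodrigues k (real n * t)"
  by (induction n) (simp_all add: fun_eq_iff rodrigues_add assms algebra_simps)

text \<open>Crossing with \<open>k\<close> is skew-adjoint, so the adjoint of the rotation by
  \<open>t\<close> is the rotation by \<open>- t\<close>, its inverse.\<close>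

lemma rodrigues_inner:
  assumes "norm k = 1"
  shows "rodrigues k t x \<bullet> rodrigues k t y = x \<bullet> y"
proof -
  have skew: "(k \<times> v) \<bullet> w = - (v \<bullet> (k \<times> w))" for v w
    by (simp add: cross3_simps)
  have "rodrigues k t x \<bullet> z = x \<bullet> rodrigues k (- t) z" for z
    by (simp add: rodrigues_def inner_add inner_diff skew)
  then show ?thesis
    by (simp add: rodrigues_add assms)
qed

lemma norm_rodrigues: "norm k = 1 \<Longrightarrow> norm (rodrigues k t x) = norm x"
  by (simp add: norm_eq_sqrt_inner rodrigues_inner)

lemma angle_rodrigues: "norm k = 1 \<Longrightarrow> angle (rodrigues k t x) (rodrigues k t y) = angle x y"
  by (simp add: angle_def norm_rodrigues rodrigues_inner)

lemma norm_cross3_le: "norm (x \<times> y) \<le> norm x * norm y"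
  proof -
  have "(norm (x \<times> y))\<^sup>2 \<le> (norm x * norm y)\<^sup>2"
    using norm_cross_dot[of x y] by (metis le_add_same_cancel1 zero_le_power2)
  then show ?thesis
    by (rule power2_le_imp_le) simp
qed

text \<open>The linear part depends on axis and angle only through \<open>t *\<^sub>R k\<close>,
  which allows rotations about different axes to be compared. The remainders of sine and cosine
  contribute half of \<open>t\<^sup>2\<close> each.\<close>

lemma rodrigues_first_order:
  assumes k: "norm k = 1" and x: "norm x = 1"
  shows "norm (rodrigues k t x - x - (t *\<^sub>R k) \<times> x) \<le> t\<^sup>2"
proof -
  have 1: "norm (k \<times> x) \<le> 1"
    using norm_cross3_le[of k x] k x by simp
  then have 2: "norm (k \<times> (k \<times> x)) \<le> 1"
    using norm_cross3_le[of k "k \<times> x"] k by simp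
  have "rodrigues k t x - x - (t *\<^sub>R k) \<times> x
      = (sin t - t) *\<^sub>R (k \<times> x) + (1 - cos t) *\<^sub>R (k \<times> (k \<times> x))"
    by (simp add: rodrigues_def cross_mult_left algebra_simps)
  also have "norm \<dots> \<le> \<bar>sin t - t\<bar> * 1 + \<bar>1 - cos t\<bar> * 1"
    using 1 2 by (intro norm_triangle_mono) (auto intro!: mult_left_mono simp del: mult_1_right)
  also have "\<dots> \<le> t\<^sup>2"
    using abs_sin_minus_le[of t] one_minus_cos_le[of t] by simp
  finally show ?thesis .
qed

section \<open>The matrix exponential as a rotation\<close>

lemma hat_mult_vec: "hat r *v x = r \<times> x"
  by (simp add: hat_def matrix_works linear_iff cross_add_right cross_mult_right)

lemma axis_angle_rot_rodrigues:
  assumes k: "norm k = 1"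
  shows "axis_angle_rot (t *\<^sub>R k) *v x = rodrigues k t x"
proof -
  define A K where "A = hat (t *\<^sub>R k)" and "K = hat k"
  define \<delta> :: "nat \<Rightarrow> real" where "\<delta> n = (if n = 0 then 1 else 0)" for n
  define T where "T n = (1 / fact n) *\<^sub>R (((\<lambda>X. A ** X) ^^ n) (mat 1))" for n
  have A: "A *v y = t *\<^sub>R (K *v y)" for y
    by (simp add: A_def K_def hat_mult_vec cross_mult_left)
  have K3: "K *v (K *v (K *v y)) = - (K *v y)" for y
    by (simp add: K_def hat_mult_vec cross3_cross3_cross3_unit k)
  have T_Suc: "T (Suc n) *v y = (1 / real (Suc n)) *\<^sub>R (A *v (T n *v y))" for n y
    by (simp add: T_def scaleR_matrix_vector_assoc[symmetric] matrix_vector_mul_assoc[symmetric]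
        matrix_vector_mult_scaleR del: of_nat_Suc)
  have "T n *v y = (sin_coeff n * t ^ n) *\<^sub>R (K *v y)
      + (\<delta> n - cos_coeff n * t ^ n) *\<^sub>R (K *v (K *v y)) + \<delta> n *\<^sub>R y" for n y
  proof (induction n)
    case 0
    then show ?case by (simp add: T_def \<delta>_def)
  next
    case (Suc n)
    show ?case
      unfolding T_Suc Suc.IH
      by (simp add: A K3 \<delta>_def matrix_vector_right_distrib matrix_vector_mult_scaleR
          scaleR_matrix_vector_assoc[symmetric] sin_coeff_Suc cos_coeff_Suc algebra_simps
          del: of_nat_Suc)
  qed
  \<comment> \<open>As \<open>K\<^sup>3 = - K\<close>, the exponential series splits into a sine and a cosine series;
    \<open>\<delta>\<close> corrects the constant term.\<close>
  then have T: "T = (\<lambda>n. (sin_coeff n * t ^ n) *\<^sub>R K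
      + (\<delta> n - cos_coeff n * t ^ n) *\<^sub>R (K ** K) + \<delta> n *\<^sub>R mat 1)"
    by (simp add: fun_eq_iff matrix_eq matrix_vector_mult_add_rdistrib
        scaleR_matrix_vector_assoc[symmetric] matrix_vector_mul_assoc[symmetric])
  have "\<delta> sums 1"
    using sums_single[of 0 "\<lambda>_. 1::real"] by (simp add: \<delta>_def[abs_def] eq_commute)
  then have "T sums (sin t *\<^sub>R K + (1 - cos t) *\<^sub>R (K ** K) + 1 *\<^sub>R mat 1)"
    unfolding T using sin_converges[of t] cos_converges[of t]
    by (intro sums_add sums_scaleR_left sums_diff) auto
  then have "axis_angle_rot (t *\<^sub>R k) = sin t *\<^sub>R K + (1 - cos t) *\<^sub>R (K ** K) + mat 1"
    by (simp add: axis_angle_rot_def matrix_exp_def sums_iff T_def[abs_def] A_def)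
  then show ?thesis
    by (simp add: rodrigues_def matrix_vector_mult_add_rdistrib
        scaleR_matrix_vector_assoc[symmetric] matrix_vector_mul_assoc[symmetric] K_def hat_mult_vec)
qed

lemma axis_angle_exists:
  fixes r :: "real^3"
  obtains k t where "norm k = 1" "r = t *\<^sub>R k"
proof (cases "r = 0")
  case True
  then show ?thesis using that[of "axis 1 1" 0] by (simp add: norm_axis_1)
next
  case False
  then show ?thesis using that[of "r /\<^sub>R norm r" "norm r"] by simp
qed

lemma norm_axis_angle_rot [simp]: "norm (axis_angle_rot r *v x) = norm x"
  by (rule axis_angle_exists[of r]) (simp add: axis_angle_rot_rodrigues norm_rodrigues)

section \<open>Comparison of rotations about different axes\<close>

lemma angle_funpow_rodrigues_le:
  assumes k: "norm k = 1" and l: "norm l = 1"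
    and step: "\<And>y. norm y = 1 \<Longrightarrow> angle (rodrigues k t y) (rodrigues l u y) \<le> e"
    and x: "norm x = 1"
  shows "angle ((rodrigues k t ^^ n) x) ((rodrigues l u ^^ n) x) \<le> real n * e"
proof (induction n)
  case 0
  then show ?case using x by (simp add: angle_unit norm_eq_1)
next
  case (Suc n)
  let ?p = "(rodrigues k t ^^ n) x" and ?q = "(rodrigues l u ^^ n) x"
  have 1: "norm ?p = 1" "norm ?q = 1"
    by (simp_all add: rodrigues_funpow norm_rodrigues k l x)
  \<comment> \<open>The intermediate point applies the first rotation to \<open>?q\<close>: the
    first summand is the old error, since rotations preserve angles, and the second is one new
    step.\<close>
  have "angle (rodrigues k t ?p) (rodrigues l u ?q)
      \<le> angle (rodrigues k t ?p) (rodrigues k t ?q) + angle (rodrigues k t ?q) (rodrigues l u ?q)"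
    by (intro angle_triangle) (simp_all add: norm_rodrigues k l 1)
  then show ?case
    using Suc.IH step[OF 1(2)] by (simp add: angle_rodrigues k algebra_simps)
qed

text \<open>
  The rotations by \<open>a\<close> and \<open>b\<close> are the \<open>n\<close>-th powers of those by \<open>a / n\<close> and \<open>b / n\<close>. The latter
  differ by \<open>dist a b / n + O(1 / n\<^sup>2)\<close> on unit vectors, so the bound follows by
  letting \<open>n\<close> tend to infinity.
\<close>

lemma angle_axis_angle_rot_le:
  assumes x: "norm x = 1"
  shows "angle (axis_angle_rot a *v x) (axis_angle_rot b *v x) \<le> dist a b"
proof -
  obtain k t where k: "norm k = 1" and a: "a = t *\<^sub>R k"
    by (rule axis_angle_exists)
  obtain l u where l: "norm l = 1" and b: "b = u *\<^sub>R l"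
    by (rule axis_angle_exists)
  define D C L where "D = dist a b" and "C = t\<^sup>2 + u\<^sup>2" and "L = 1 - pi / 4"
  define f where "f n = D / real n + C / (real n)\<^sup>2" for n :: nat
  have L: "L > 0"
    using pi_less_4 by (simp add: L_def)
  have le: "angle (axis_angle_rot a *v x) (axis_angle_rot b *v x)
      \<le> real n * (f n + (f n / L)\<^sup>2 / 4)" if n: "n > 0" for n
  proof -
    let ?F = "rodrigues k (t / real n)" and ?G = "rodrigues l (u / real n)"
    have "angle (?F y) (?G y) \<le> f n + (f n / L)\<^sup>2 / 4" if y: "norm y = 1" for y
    proof -
      \<comment> \<open>The two linear parts differ by the cross product of
        \<open>(a - b) / n\<close> with \<open>y\<close>, which yields \<open>D / n\<close>; the
        remainders yield \<open>C / n\<^sup>2\<close>.\<close>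
      have "?F y - ?G y = (?F y - y - ((t / real n) *\<^sub>R k) \<times> y)
          - (?G y - y - ((u / real n) *\<^sub>R l) \<times> y) + (1 / real n) *\<^sub>R ((a - b) \<times> y)"
        by (simp add: a b cross_mult_left cross_diff_left left_diff_distrib algebra_simps)
      also have "norm \<dots> \<le> (t / real n)\<^sup>2 + (u / real n)\<^sup>2 + (1 / real n) * (D * 1)"
        using norm_cross3_le[of "a - b" y] y n
        by (intro norm_triangle_mono norm_triangle_le_diff add_mono rodrigues_first_order k l y)
          (auto simp: D_def dist_norm divide_right_mono)
      also have "\<dots> = f n"
        by (simp add: f_def C_def power_divide add_divide_distrib)
      finally have d: "norm (?F y - ?G y) \<le> f n" .
      have "angle (?F y) (?G y) \<le> norm (?F y - ?G y) + (norm (?F y - ?G y) / L)\<^sup>2 / 4"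
        unfolding L_def by (intro angle_le_chord) (simp_all add: norm_rodrigues k l y)
      also have "\<dots> \<le> f n + (f n / L)\<^sup>2 / 4"
        using d L by (intro add_mono divide_right_mono power_mono) auto
      finally show ?thesis .
    qed
    then have "angle ((?F ^^ n) x) ((?G ^^ n) x) \<le> real n * (f n + (f n / L)\<^sup>2 / 4)"
      by (intro angle_funpow_rodrigues_le k l x)
    then show ?thesis
      using n by (simp add: rodrigues_funpow k l a b axis_angle_rot_rodrigues)
  qed
  \<comment> \<open>Since \<open>f n\<close> is \<open>1 / n\<close> times a bounded quantity, the
    factor \<open>n\<close> cancels and every term except \<open>D\<close> keeps a factor
    \<open>1 / n\<close>.\<close>
  have eq: "real n * (f n + (f n / L)\<^sup>2 / 4)
      = D + C * (1 / real n) + (D + C * (1 / real n))\<^sup>2 * (1 / real n) / (4 * L\<^sup>2)" if "n > 0" for n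
  proof -
    define g where "g = D + C * (1 / real n)"
    have "f n = g / real n"
      by (simp add: f_def g_def add_divide_distrib power2_eq_square)
    then show ?thesis
      using that unfolding g_def[symmetric]
      by (simp add: distrib_left power_divide power2_eq_square)
  qed
  have "(\<lambda>n. D + C * (1 / real n) + (D + C * (1 / real n))\<^sup>2 * (1 / real n) / (4 * L\<^sup>2))
      \<longlonglongrightarrow> D + C * 0 + (D + C * 0)\<^sup>2 * 0 / (4 * L\<^sup>2)"
    using L by (intro tendsto_intros lim_1_over_n) auto
  then show ?thesis
    unfolding D_def[symmetric] using le eq
    by (intro tendsto_lowerbound[of _ D sequentially])
      (auto simp: eventually_sequentially Suc_le_eq simp del: times_divide_eq_right intro!: exI[of _ 1])
qed

subsection \<open>The bound on a cube\<close>

lemma dist_centre_cube_le: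
  assumes "is_cube B u \<alpha>" "r \<in> B"
  shows "dist u r \<le> \<alpha>"
proof -
  obtain h where h: "h \<ge> 0" "B = cbox (u - vec h) (u + vec h)" "\<alpha> = dist u (u + vec h)"
    using assms(1) by (auto simp: is_cube_def)
  \<comment> \<open>No coordinate of \<open>u - r\<close> exceeds \<open>h\<close> in absolute
    value, so a vertex is a farthest point from the centre.\<close>
  have "\<bar>(u - r) $ i\<bar> \<le> \<bar>(vec h :: real^3) $ i\<bar>" for i
    using assms(2) h by (auto simp: mem_box_cart abs_le_iff dest: spec[of _ i])
  then have "norm (u - r) \<le> norm (vec h :: real^3)"
    by (intro norm_le_componentwise_cart) (simp only: real_norm_def)
  then show ?thesis
    by (simp add: h dist_norm)
qed

lemma Q_ROSIA_le_Qbar_ROSIA: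
  assumes M: "M \<ge> 1"
    and s: "\<And>i. i \<in> {1..N} \<Longrightarrow> norm (s i) = 1"
    and c: "\<And>j. j \<in> {1..M} \<Longrightarrow> norm (c j) = 1"
    and r: "dist u r \<le> \<alpha>"
  shows "Q_ROSIA N M K \<epsilon> s c (axis_angle_rot r) \<le> Qbar_ROSIA N M K \<epsilon> s c u \<alpha>"
  unfolding Q_ROSIA_def Qbar_ROSIA_def
proof (intro sum_mono Max.boundedI, goal_cases)
  \<comment> \<open>The index \<open>j\<close> that produces the value \<open>m\<close> in the
    objective also serves as the witness in the bounding maximum. The other two goals are finiteness
    and nonemptiness of the set of values.\<close>
  case (3 i m)
  then obtain j where j: "j \<in> {1..M}" and m: "m = of_bool (angle (axis_angle_rot r *v s i) (c j) \<le> \<epsilon>) *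
        (\<Prod>k=1..K. of_bool (\<bar>sorted_dist N s i k - sorted_dist M c j k\<bar> \<le> 2 * \<epsilon>))"
    by auto
  have "angle (axis_angle_rot u *v s i) (c j)
      \<le> angle (axis_angle_rot u *v s i) (axis_angle_rot r *v s i) + angle (axis_angle_rot r *v s i) (c j)"
    using 3 j s c by (intro angle_triangle) simp_all
  also have "\<dots> \<le> \<alpha> + angle (axis_angle_rot r *v s i) (c j)"
    using angle_axis_angle_rot_le[of "s i" u r] s[of i] 3 r by simp
  finally have "m \<le> of_bool (angle (axis_angle_rot u *v s i) (c j) \<le> \<epsilon> + \<alpha>) *
        (\<Prod>k=1..K. of_bool (\<bar>sorted_dist N s i k - sorted_dist M c j k\<bar> \<le> 2 * \<epsilon>))"
    unfolding m by (intro mult_right_mono) auto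
  also have "\<dots> \<le> (MAX j\<in>{1..M}. of_bool (angle (axis_angle_rot u *v s i) (c j) \<le> \<epsilon> + \<alpha>) *
        (\<Prod>k=1..K. of_bool (\<bar>sorted_dist N s i k - sorted_dist M c j k\<bar> \<le> 2 * \<epsilon>)))"
    using j by (intro Max_ge) auto
  finally show ?case .
qed (use M in auto)

theorem lemma1:
  fixes N M K :: nat and \<epsilon> :: real
    and s c :: "nat \<Rightarrow> real^3"
    and B :: "(real^3) set" and u :: "real^3" and \<alpha> :: real
  assumes "N \<ge> 1" and "M \<ge> 1"
    and "\<And>i. i \<in> {1..N} \<Longrightarrow> norm (s i) = 1"
    and "\<And>j. j \<in> {1..M} \<Longrightarrow> norm (c j) = 1"
    and "\<epsilon> \<ge> 0"
    and "K \<le> min (N - 1) (M - 1)"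
    and "is_cube B u \<alpha>"
  shows "Qbar_ROSIA N M K \<epsilon> s c u \<alpha> \<ge> (MAX r\<in>B. Q_ROSIA N M K \<epsilon> s c (axis_angle_rot r)) \<and>
    (\<forall>r. u = r \<and> \<alpha> = 0 \<longrightarrow>
      Qbar_ROSIA N M K \<epsilon> s c u \<alpha> = Q_ROSIA N M K \<epsilon> s c (axis_angle_rot r))"
proof
  have le: "Q_ROSIA N M K \<epsilon> s c (axis_angle_rot r) \<le> Qbar_ROSIA N M K \<epsilon> s c u \<alpha>" if "r \<in> B" for r
    using that assms by (intro Q_ROSIA_le_Qbar_ROSIA dist_centre_cube_le[of B]) auto
  \<comment> \<open>The cube may be infinite, but the values are natural numbers below a fixed
    bound, so \<open>Max\<close> is a genuine maximum; the centre \<open>u\<close> shows that there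
    is at least one value.\<close>
  then have "finite ((\<lambda>r. Q_ROSIA N M K \<epsilon> s c (axis_angle_rot r)) ` B)"
    by (intro finite_subset[OF _ finite_atMost]) auto
  moreover have "u \<in> B"
    using assms(7) by (auto simp: is_cube_def mem_box_cart)
  ultimately show "(MAX r\<in>B. Q_ROSIA N M K \<epsilon> s c (axis_angle_rot r)) \<le> Qbar_ROSIA N M K \<epsilon> s c u \<alpha>"
    using le by (subst Max_le_iff) auto
  \<comment> \<open>With \<open>\<alpha> = 0\<close> the relaxed threshold
    \<open>\<epsilon> + \<alpha>\<close> is \<open>\<epsilon>\<close>, and the two sums coincide
    term by term.\<close>
  show "\<forall>r. u = r \<and> \<alpha> = 0 \<longrightarrow>
      Qbar_ROSIA N M K \<epsilon> s c u \<alpha> = Q_ROSIA N M K \<epsilon> s c (axis_angle_rot r)"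
    by (simp add: Q_ROSIA_def Qbar_ROSIA_def)
qed

end
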